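(* Let $G=G(l)$ be a connected labeled graph with labeling $l\colon V(G)\to\mathbb{R}^+$, and let $d_l\colon V(G)\times V(G)\to\mathbb{R}^+$ be the mapping generated by $G(l)$. Then $d_l$ is a pseudoultrametric on $V(G)$. Moreover, if $G$ is locally finite, then $d_l$ is an ultrametric on $V(G)$ if and only if the inequality \[ \max\{l(u),l(v)\}>0 \] holds for every edge $\{u,v\}\in E(G)$.
   Context: $\mathbb{R}^+:=[0,\infty)$. A graph $G$ is a pair $(V,E)$ with $V=V(G)$ a non-empty (possibly infinite) set and $E=E(G)$ a (possibly empty) set of unordered pairs of distinct elements of $V$ (no loops, no multiple edges). A path is a graph with vertex set $\{x_0,\dots,x_k\}$, all $x_i$ distinct, $k\ge 1$, and edge set $\{\{x_0,x_1\},\dots,\{x_{k-1},x_k\}\}$; it joins $x_0$ and $x_k$. $G$ is connected if any two distinct vertices are joined by a path contained in $G$ (one-vertex graphs are connected). $G$ is locally finite if every vertex has finitely many adjacent vertices. A labeled graph $G(l)$ is a graph $G$ together with a labeling $l\colon V(G)\to\mathbb{R}^+$. For a connected labeled graph $G(l)$, the mapping $d_l\colon V(G)\times V(G)\to\mathbb{R}^+$ generated by $G(l)$ is \[ d_l(x,y):=\begin{cases}0,& x=y,\\ \inf\limits_{P\in\mathcal{P}_{x,y}}\Big(\max\limits_{v\in V(P)}l(v)\Big),& x\ne y,\end{cases} \] where $\mathcal{P}_{x,y}$ is the set of all paths joining $x$ and $y$ in $G$. A pseudoultrametric on a non-empty set $X$ is a function $d\colon X\times X\to\mathbb{R}^+$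 such that $d(x,y)=d(y,x)$, $d(x,x)=0$ and $d(x,y)\le\max\{d(x,z),d(z,y)\}$ for all $x,y,z\in X$. It is an ultrametric if in addition $d(x,y)=0$ implies $x=y$. *)

theory Defs
  imports Complex_Main
begin

text \<open>
  A graph is a pair of a vertex set and a set of edges, each edge being the unordered pair of its
  ends, that is, a two-element set.
\<close>

type_synonym 'a ugraph = "'a set \<times> 'a set set"

abbreviation verts :: "'a ugraph \<Rightarrow> 'a set" where
  "verts G \<equiv> fst G"

abbreviation edges :: "'a ugraph \<Rightarrow> 'a set set" where
  "edges G \<equiv> snd G"

definition is_graph :: "'a ugraph \<Rightarrow> bool" where
  "is_graph G \<longleftrightarrow>
     verts G \<noteq> {} \<and> edges G \<subseteq> {{u, v} |u v. u \<in> verts G \<and> v \<in> verts G \<and> u \<noteq> v}"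

definition subgraph_of :: "'a ugraph \<Rightarrow> 'a ugraph \<Rightarrow> bool" where
  "subgraph_of H G \<longleftrightarrow> verts H \<subseteq> verts G \<and> edges H \<subseteq> edges G"

definition is_path_joining :: "'a ugraph \<Rightarrow> 'a \<Rightarrow> 'a \<Rightarrow> bool" where
  "is_path_joining P a b \<longleftrightarrow>
     (\<exists>(x :: nat \<Rightarrow> 'a) k. 1 \<le> k \<and> inj_on x {0..k} \<and> x 0 = a \<and> x k = b \<and>
        verts P = x ` {0..k} \<and> edges P = {{x i, x (Suc i)} |i. i < k})"

definition paths_joining :: "'a ugraph \<Rightarrow> 'a \<Rightarrow> 'a \<Rightarrow> 'a ugraph set" where
  "paths_joining G a b = {P. is_path_joining P a b \<and> subgraph_of P G}"

definition connected_graph :: "'a ugraph \<Rightarrow> bool" where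
  "connected_graph G \<longleftrightarrow>
     is_graph G \<and>
     (\<forall>a \<in> verts G. \<forall>b \<in> verts G. a \<noteq> b \<longrightarrow> (\<exists>P. is_path_joining P a b \<and> subgraph_of P G))"

definition locally_finite_graph :: "'a ugraph \<Rightarrow> bool" where
  "locally_finite_graph G \<longleftrightarrow> (\<forall>v \<in> verts G. finite {u \<in> verts G. {u, v} \<in> edges G})"

text \<open>Only the values of a labeling on the vertices are constrained or used.\<close>

definition is_labeling :: "'a ugraph \<Rightarrow> ('a \<Rightarrow> real) \<Rightarrow> bool" where
  "is_labeling G l \<longleftrightarrow> (\<forall>v \<in> verts G. 0 \<le> l v)"

text \<open>
  For distinct vertices of a connected graph with a nonnegative labeling, the set of maxima below is
  nonempty and bounded below by 0, so that the real-valued \<open>INF\<close> is the actual infimum; \<open>Max\<close> is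
  taken over the finite nonempty vertex set of a path.
\<close>

definition generated_dist :: "'a ugraph \<Rightarrow> ('a \<Rightarrow> real) \<Rightarrow> 'a \<Rightarrow> 'a \<Rightarrow> real" where
  "generated_dist G l x y =
     (if x = y then 0 else (INF P \<in> paths_joining G x y. Max (l ` verts P)))"

definition pseudoultrametric_on :: "'a set \<Rightarrow> ('a \<Rightarrow> 'a \<Rightarrow> real) \<Rightarrow> bool" where
  "pseudoultrametric_on X d \<longleftrightarrow>
     X \<noteq> {} \<and>
     (\<forall>x \<in> X. \<forall>y \<in> X. 0 \<le> d x y) \<and>
     (\<forall>x \<in> X. \<forall>y \<in> X. d x y = d y x) \<and>
     (\<forall>x \<in> X. d x x = 0) \<and>
     (\<forall>x \<in> X. \<forall>y \<in> X. \<forall>z \<in> X. d x y \<le> max (d x z) (d z y))"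

definition ultrametric_on :: "'a set \<Rightarrow> ('a \<Rightarrow> 'a \<Rightarrow> real) \<Rightarrow> bool" where
  "ultrametric_on X d \<longleftrightarrow>
     pseudoultrametric_on X d \<and> (\<forall>x \<in> X. \<forall>y \<in> X. d x y = 0 \<longrightarrow> x = y)"

end

theory Submission imports Defs begin

text \<open>
  For distinct vertices, \<open>d\<^sub>l(x,y) < t\<close> forces \<open>x\<close> and \<open>y\<close> to be connected inside the
  subgraph induced on \<open>{v. l v \<le> t}\<close>, and such a connection forces \<open>d\<^sub>l(x,y) \<le> t\<close>; since being
  connected is an equivalence relation, symmetry and the strong triangle inequality follow by
  letting \<open>t\<close> decrease. If \<open>G\<close> is locally finite and \<open>d\<^sub>l(x,y) = 0\<close> with \<open>x \<noteq> y\<close>, take \<open>t > 0\<close>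
  below all positive labels of \<open>x\<close> and its neighbours: the first edge of a connection at
  level \<open>t\<close> has both labels equal to \<open>0\<close>.
\<close>

section \<open>Simple paths and connectedness inside an induced subgraph\<close>

definition induced_adj :: "'a ugraph \<Rightarrow> 'a set \<Rightarrow> ('a \<times> 'a) set" where
  "induced_adj G S = {(u, v). {u, v} \<in> edges G \<and> u \<in> S \<and> v \<in> S}"

lemma edge_ends:
  assumes "is_graph G" "{u, v} \<in> edges G"
  shows "u \<in> verts G" "v \<in> verts G" "u \<noteq> v"
  using assms unfolding is_graph_def by (auto simp: doubleton_eq_iff)

lemma sym_induced_adj: "sym (induced_adj G S)"
  by (auto simp: sym_def induced_adj_def insert_commute)

text \<open>In the reflexive transitive closure, joining two connections is mere transitivity;
  repeated vertices have to be removed only here. Induction along the connection keeps a simple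
  path: a new end vertex is either appended or, if already visited, the path is cut there.\<close>

lemma path_seq_of_induced_rtrancl:
  assumes "is_graph G" "(a, b) \<in> (induced_adj G S)\<^sup>*" "a \<noteq> b"
  obtains x k where "1 \<le> k" "inj_on x {0..k}" "x 0 = a" "x k = b"
    "x ` {0..k} \<subseteq> S \<inter> verts G" "\<And>i. i < k \<Longrightarrow> {x i, x (Suc i)} \<in> edges G"
proof -
  \<comment> \<open>The distinctness is part of the induction claim because the closure is
    reflexive, while a path has at least one edge.\<close>
  have "a \<noteq> b \<longrightarrow> (\<exists>x (k::nat). 1 \<le> k \<and> inj_on x {0..k} \<and> x 0 = a \<and> x k = b \<and>
      x ` {0..k} \<subseteq> S \<inter> verts G \<and> (\<forall>i<k. {x i, x (Suc i)} \<in> edges G))"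
    using assms(2)
  proof (induction rule: rtrancl_induct)
    case base
    then show ?case by simp
  next
    case (step y z)
    from step.hyps(2) have yz: "{y, z} \<in> edges G" "y \<in> S" "z \<in> S"
      by (auto simp: induced_adj_def)
    note ends = edge_ends[OF assms(1) yz(1)]
    show ?case
    proof
      assume az: "a \<noteq> z"
      show "\<exists>x (k::nat). 1 \<le> k \<and> inj_on x {0..k} \<and> x 0 = a \<and> x k = z \<and>
          x ` {0..k} \<subseteq> S \<inter> verts G \<and> (\<forall>i<k. {x i, x (Suc i)} \<in> edges G)"
      \<comment> \<open>If \<open>a = y\<close>, the induction hypothesis yields no path to extend,
        and the single edge from \<open>y\<close> to \<open>z\<close> is the path.\<close>
      proof (cases "a = y")
        case True
        then show ?thesis
          using yz ends
          by (intro exI[of _ "\<lambda>i::nat. if i = 0 then y else z"] exI[of _ 1])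
            (auto simp: inj_on_def)
      next
        case False
        then obtain x k where x: "1 \<le> (k::nat)" "inj_on x {0..k}" "x 0 = a" "x k = y"
          "x ` {0..k} \<subseteq> S \<inter> verts G" "\<forall>i<k. {x i, x (Suc i)} \<in> edges G"
          using step.IH by blast
        show ?thesis
        proof (cases "z \<in> x ` {0..k}")
          case True
          then obtain j where j: "j \<le> k" "x j = z" by auto
          \<comment> \<open>The prefix ending at \<open>z\<close> still has an edge, since position
            0 is occupied by \<open>a\<close>.\<close>
          with az x(3) have "1 \<le> j" by (cases j) auto
          moreover have sub: "{0..j} \<subseteq> {0..k}" using j by auto
          moreover have "inj_on x {0..j}" using inj_on_subset[OF x(2) sub] .
          ultimately show ?thesis
            using x j by (intro exI[of _ x] exI[of _ j]) auto
        next
          case False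
          have eq: "(x(Suc k := z)) ` {0..k} = x ` {0..k}"
            by (rule image_cong) auto
          have "inj_on (x(Suc k := z)) {0..k}"
            using x(2) by (subst inj_on_cong[of _ _ x]) auto
          then have "inj_on (x(Suc k := z)) {0..Suc k}"
            using False by (auto simp: atLeast0_atMost_Suc eq)
          moreover have "(x(Suc k := z)) ` {0..Suc k} \<subseteq> S \<inter> verts G"
            using x(5) yz ends by (auto simp: atLeast0_atMost_Suc)
          moreover have "\<forall>i<Suc k. {(x(Suc k := z)) i, (x(Suc k := z)) (Suc i)} \<in> edges G"
            using x(4,6) yz by (auto simp: less_Suc_eq)
          ultimately show ?thesis
            using x(3) by (intro exI[of _ "x(Suc k := z)"] exI[of _ "Suc k"]) auto
        qed
      qed
    qed
  qed
  then show ?thesis using that assms(3) by blast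
qed

lemma ex_path_within_if_rtrancl:
  assumes "is_graph G" "(a, b) \<in> (induced_adj G S)\<^sup>*" "a \<noteq> b"
  shows "\<exists>P \<in> paths_joining G a b. verts P \<subseteq> S"
proof -
  obtain x k where x: "1 \<le> k" "inj_on x {0..k}" "x 0 = a" "x k = b"
    "x ` {0..k} \<subseteq> S \<inter> verts G" "\<And>i. i < k \<Longrightarrow> {x i, x (Suc i)} \<in> edges G"
    using path_seq_of_induced_rtrancl[OF assms] by blast
  define P where "P = (x ` {0..k}, {{x i, x (Suc i)} |i. i < k})"
  have "is_path_joining P a b"
    unfolding is_path_joining_def P_def using x by (intro exI[of _ x] exI[of _ k]) auto
  moreover have "subgraph_of P G"
    unfolding subgraph_of_def P_def using x by auto
  ultimately have "P \<in> paths_joining G a b"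
    by (simp add: paths_joining_def)
  moreover have "verts P \<subseteq> S"
    using x(5) by (simp add: P_def)
  ultimately show ?thesis by blast
qed

lemma rtrancl_if_path_within:
  assumes "P \<in> paths_joining G a b" "verts P \<subseteq> S"
  shows "(a, b) \<in> (induced_adj G S)\<^sup>*"
proof -
  obtain x k where x: "x 0 = a" "x k = b" "verts P = x ` {0..k}"
    "edges P = {{x i, x (Suc i)} |i. i < k}" and sub: "edges P \<subseteq> edges G"
    using assms(1) by (auto simp: paths_joining_def is_path_joining_def subgraph_of_def)
  have "(x 0, x i) \<in> (induced_adj G S)\<^sup>*" if "i \<le> k" for i
    using that
  proof (induction i)
    case (Suc i)
    then have "{x i, x (Suc i)} \<in> edges P" using x(4) by auto
    with Suc.prems have "(x i, x (Suc i)) \<in> induced_adj G S"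
      using x(3) sub assms(2) by (auto simp: induced_adj_def)
    with Suc show ?case by (auto intro: rtrancl_into_rtrancl)
  qed simp
  with x(1,2) show ?thesis by auto
qed

section \<open>Sublevel sets of the labeling and the infimum over paths\<close>

lemma path_verts_finite_nonempty:
  assumes "P \<in> paths_joining G a b"
  shows "finite (verts P)" "verts P \<noteq> {}" "verts P \<subseteq> verts G"
  using assms by (auto simp: paths_joining_def is_path_joining_def subgraph_of_def)

lemma Max_path_nonneg:
  assumes "is_labeling G l" "P \<in> paths_joining G a b"
  shows "0 \<le> Max (l ` verts P)"
  using path_verts_finite_nonempty[OF assms(2)] assms(1)
  by (auto simp: is_labeling_def Max_ge_iff)

text \<open>The inequality is not strict, so that level 0 captures the edges with both labels
  0.\<close>

abbreviation sublevel_adj :: "'a ugraph \<Rightarrow> ('a \<Rightarrow> real) \<Rightarrow> real \<Rightarrow> ('a \<times> 'a) set" where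
  "sublevel_adj G l t \<equiv> induced_adj G {v. l v \<le> t}"

text \<open>A simple path extracted from the connection has maximal label at most \<open>t\<close>,
  and the infimum lies below this maximum.\<close>

lemma generated_dist_le_if_sublevel:
  assumes "is_graph G" "is_labeling G l" "a \<noteq> b" "(a, b) \<in> (sublevel_adj G l t)\<^sup>*"
  shows "generated_dist G l a b \<le> t"
proof -
  obtain P where P: "P \<in> paths_joining G a b" "verts P \<subseteq> {v. l v \<le> t}"
    using ex_path_within_if_rtrancl[OF assms(1,4,3)] by blast
  have "Max (l ` verts P) \<le> t"
    using path_verts_finite_nonempty[OF P(1)] P(2) by auto
  \<comment> \<open>Nonnegative labels make the real infimum a genuine lower bound.\<close>
  moreover have "bdd_below ((\<lambda>P. Max (l ` verts P)) ` paths_joining G a b)"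
    using Max_path_nonneg[OF assms(2)] by (intro bdd_belowI2)
  ultimately show ?thesis
    using P(1) assms(3) by (auto simp: generated_dist_def intro: cINF_lower2)
qed

lemma paths_joining_nonempty:
  assumes "connected_graph G" "a \<in> verts G" "b \<in> verts G" "a \<noteq> b"
  shows "paths_joining G a b \<noteq> {}"
  using assms by (auto simp: connected_graph_def paths_joining_def)

text \<open>In an infinite graph the infimum need not be attained; strictness of the inequality
  provides a path whose maximal label is below \<open>t\<close>.\<close>

lemma sublevel_if_generated_dist_less:
  assumes "connected_graph G" "is_labeling G l" "a \<in> verts G" "b \<in> verts G" "a \<noteq> b"
    and "generated_dist G l a b < t"
  shows "(a, b) \<in> (sublevel_adj G l t)\<^sup>*"
proof -
  have "bdd_below ((\<lambda>P. Max (l ` verts P)) ` paths_joining G a b)"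
    using Max_path_nonneg[OF assms(2)] by (intro bdd_belowI2)
  then obtain P where P: "P \<in> paths_joining G a b" "Max (l ` verts P) < t"
    using assms(5,6) paths_joining_nonempty[OF assms(1,3-5)]
    by (auto simp: generated_dist_def cINF_less_iff)
  have "verts P \<subseteq> {v. l v \<le> t}"
    using P(2) path_verts_finite_nonempty[OF P(1)] by auto
  with P(1) show ?thesis by (rule rtrancl_if_path_within)
qed

section \<open>The pseudoultrametric axioms\<close>

lemma generated_dist_nonneg:
  assumes "connected_graph G" "is_labeling G l" "a \<in> verts G" "b \<in> verts G"
  shows "0 \<le> generated_dist G l a b"
  using assms paths_joining_nonempty[OF assms(1,3,4)] Max_path_nonneg[OF assms(2)]
  by (auto simp: generated_dist_def intro: cINF_greatest)

text \<open>Connections at every level \<open>t\<close> above the right-hand side can be reversed.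
  Exchanging \<open>a\<close> and \<open>b\<close> later turns the inequality into symmetry.\<close>

lemma generated_dist_commute_le:
  assumes "connected_graph G" "is_labeling G l" "a \<in> verts G" "b \<in> verts G"
  shows "generated_dist G l a b \<le> generated_dist G l b a"
proof (cases "a = b")
  case False
  have g: "is_graph G" using assms(1) by (simp add: connected_graph_def)
  show ?thesis
  proof (rule dense_ge)
    fix t assume "generated_dist G l b a < t"
    then have "(b, a) \<in> (sublevel_adj G l t)\<^sup>*"
      using sublevel_if_generated_dist_less assms False by metis
    then have "(a, b) \<in> (sublevel_adj G l t)\<^sup>*"
      using symD[OF sym_rtrancl[OF sym_induced_adj]] by metis
    then show "generated_dist G l a b \<le> t"
      using generated_dist_le_if_sublevel[OF g assms(2) False] by simp
  qed
qed simp

lemma generated_dist_strong_triangle: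
  assumes "connected_graph G" "is_labeling G l" "a \<in> verts G" "b \<in> verts G" "c \<in> verts G"
  shows "generated_dist G l a b \<le> max (generated_dist G l a c) (generated_dist G l c b)"
proof -
  have g: "is_graph G" using assms(1) by (simp add: connected_graph_def)
  \<comment> \<open>Coinciding points are split off because their distance is 0 by convention,
    whatever their labels. If \<open>c\<close> is \<open>a\<close> or \<open>b\<close>, one term of
    the maximum is the left-hand side itself.\<close>
  consider "a = b" | "c = a \<or> c = b" | "a \<noteq> b" "a \<noteq> c" "c \<noteq> b" by blast
  then show ?thesis
  proof cases
    case 1
    then show ?thesis
      using generated_dist_nonneg[OF assms(1,2,3,5)]
      by (simp add: generated_dist_def[of _ _ b b] le_max_iff_disj)
  next
    case 2
    then show ?thesis by (auto simp: le_max_iff_disj)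
  next
    case 3
    show ?thesis
    proof (rule dense_ge)
      fix t assume "max (generated_dist G l a c) (generated_dist G l c b) < t"
      then have "(a, c) \<in> (sublevel_adj G l t)\<^sup>*" "(c, b) \<in> (sublevel_adj G l t)\<^sup>*"
        using sublevel_if_generated_dist_less assms 3 by (metis max_less_iff_conj)+
      then have "(a, b) \<in> (sublevel_adj G l t)\<^sup>*" by (rule rtrancl_trans)
      then show "generated_dist G l a b \<le> t"
        using generated_dist_le_if_sublevel[OF g assms(2) 3(1)] by simp
    qed
  qed
qed

lemma pseudoultrametric_generated_dist:
  assumes "connected_graph G" "is_labeling G l"
  shows "pseudoultrametric_on (verts G) (generated_dist G l)"
proof -
  have "verts G \<noteq> {}"
    using assms(1) by (simp add: connected_graph_def is_graph_def)
  moreover have "generated_dist G l a a = 0" for a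
    by (simp add: generated_dist_def)
  ultimately show ?thesis
    unfolding pseudoultrametric_on_def
    using generated_dist_nonneg[OF assms] generated_dist_commute_le[OF assms]
      generated_dist_strong_triangle[OF assms]
    by (auto intro: antisym)
qed

section \<open>Separation of points\<close>

lemma ex_pos_below_positive_elements:
  fixes A :: "real set"
  assumes "finite A"
  obtains t where "0 < t" "\<And>a. a \<in> A \<Longrightarrow> a \<le> t \<Longrightarrow> a \<le> 0"
proof -
  \<comment> \<open>Inserting 1 keeps the minimum defined and positive when no element of
    \<open>A\<close> is positive.\<close>
  define m where "m = Min (insert 1 {a \<in> A. 0 < a})"
  have "0 < m" using assms by (auto simp: m_def)
  moreover have "m \<le> a" if "a \<in> A" "0 < a" for a
    using assms that by (auto simp: m_def)
  ultimately show ?thesis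
    \<comment> \<open>Halving gives \<open>m / 2 < m\<close>, so an element up to
      \<open>m / 2\<close> cannot be positive.\<close>
    using that[of "m / 2"] by (smt (verit) field_sum_of_halves)
qed

theorem theorem3p3:
  fixes G :: "'a ugraph" and l :: "'a \<Rightarrow> real"
  assumes "connected_graph G" and "is_labeling G l"
  shows "pseudoultrametric_on (verts G) (generated_dist G l) \<and>
    (locally_finite_graph G \<longrightarrow>
      (ultrametric_on (verts G) (generated_dist G l) \<longleftrightarrow>
        (\<forall>u v. {u, v} \<in> edges G \<longrightarrow> max (l u) (l v) > 0)))"
proof -
  have g: "is_graph G" using assms(1) by (simp add: connected_graph_def)
  note pseudo = pseudoultrametric_generated_dist[OF assms]
  have "max (l u) (l v) > 0"
    if um: "ultrametric_on (verts G) (generated_dist G l)" and e: "{u, v} \<in> edges G" for u v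
  proof (rule ccontr)
    assume "\<not> max (l u) (l v) > 0"
    \<comment> \<open>An edge with both labels 0 is itself a connection at level 0.\<close>
    with e have "(u, v) \<in> sublevel_adj G l 0" by (auto simp: induced_adj_def)
    then have "generated_dist G l u v \<le> 0"
      using generated_dist_le_if_sublevel[OF g assms(2)] edge_ends[OF g e] by blast
    then have "generated_dist G l u v = 0"
      using generated_dist_nonneg[OF assms] edge_ends[OF g e] by (meson antisym)
    with um show False
      using edge_ends[OF g e] by (auto simp: ultrametric_on_def)
  qed
  moreover have "ultrametric_on (verts G) (generated_dist G l)"
    if lf: "locally_finite_graph G"
      and pos: "\<forall>u v. {u, v} \<in> edges G \<longrightarrow> max (l u) (l v) > 0"
  proof -
    have "a = b" if ab: "a \<in> verts G" "b \<in> verts G" "generated_dist G l a b = 0" for a b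
    proof (rule ccontr)
      assume "a \<noteq> b"
      \<comment> \<open>Local finiteness enters through \<open>N\<close>: infinitely many neighbours
        could have positive labels accumulating at 0, leaving no suitable \<open>t\<close>.\<close>
      define N where "N = insert a {u \<in> verts G. {u, a} \<in> edges G}"
      have "finite (l ` N)"
        using lf ab(1) by (auto simp: locally_finite_graph_def N_def)
      then obtain t where t: "0 < t" "\<And>r. r \<in> l ` N \<Longrightarrow> r \<le> t \<Longrightarrow> r \<le> 0"
        by (rule ex_pos_below_positive_elements) blast
      have "(a, b) \<in> (sublevel_adj G l t)\<^sup>*"
        using sublevel_if_generated_dist_less[OF assms ab(1,2) \<open>a \<noteq> b\<close>] ab(3) t(1) by simp
      \<comment> \<open>As \<open>a \<noteq> b\<close>, the connection has a first edge; it starts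
        at \<open>a\<close>, so both its ends lie in \<open>N\<close>.\<close>
      then obtain w where w: "(a, w) \<in> sublevel_adj G l t"
        using \<open>a \<noteq> b\<close> by (auto elim: converse_rtranclE)
      then have e: "{a, w} \<in> edges G" and le: "l a \<le> t" "l w \<le> t"
        by (auto simp: induced_adj_def)
      have "w \<in> N"
        using e edge_ends[OF g e] by (auto simp: N_def insert_commute)
      then have "l a \<le> 0" "l w \<le> 0"
        using t(2) le by (auto simp: N_def)
      with pos e show False by fastforce
    qed
    with pseudo show ?thesis by (auto simp: ultrametric_on_def)
  qed
  ultimately show ?thesis using pseudo by blast
qed

end
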